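(* Let $f$ be an increasing chocolate function. For each $x\in\mathbb{Z}_{\ge 0}$ let $$F_x(z)=2^{\lceil \log_2 (f(x)+1)\rceil}-f(z)-1\qquad (0\le z\le x),$$ extended by $F_x(z)=F_x(x)$ for $z>x$. If $\mathrm{ICG}(f,x,y)$ is tasty for all $x,y\in\mathbb{Z}_{\ge 0}$, then $\mathrm{DCG}(F_x,x,y)$ is tasty for all $x,y\in\mathbb{Z}_{\ge 0}$.
   Context: $\oplus$ denotes Nim-sum (bitwise XOR). For a position $G$ of an impartial game (finite play), the Sprague–Grundy value is $\mathcal{G}(G)=\mathrm{mex}\{\mathcal{G}(G') : G' \text{ an option of } G\}$, where $\mathrm{mex}(S)=\min(\mathbb{Z}_{\ge 0}\setminus S)$. An increasing (resp. decreasing) chocolate function is a function $f:\mathbb{Z}_{\ge 0}\to\mathbb{Z}_{\ge 0}$ with $f(u)\le f(v)$ (resp. $f(u)\ge f(v)$) whenever $u\le v$. For an increasing (resp. decreasing) chocolate function $f$ and $x,y\in\mathbb{Z}_{\ge0}$, $\mathrm{ICG}(f,x,y)$ (resp. $\mathrm{DCG}(f,x,y)$) is the chocolate bar with columns $i=0,\dots,x$, the $i$-th of height $\min(f(i),y)+1$, with the bottom square of column $0$ bitter. A move cuts the bar along a vertical or horizontal groove and removes the part not containing the bitter square; for $\mathrm{DCG}$ at least one square of the rightmost column must be removed (for $\mathrm{ICG}$ this is automatic). Thus the options of $\mathrm{ICG}(f,x,y)$ are exactly $\mathrm{ICG}(f,x',y)$ with $0\le x'<x$ and $\mathrm{ICG}(f,x,y')$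 with $0\le y'<\min(f(x),y)$; likewise for $\mathrm{DCG}$. (A player with no legal move loses.) The position $\mathrm{ICG}(f,x,y)$, resp. $\mathrm{DCG}(f,x,y)$, depends only on the values $f(0),\dots,f(x)$. $\mathrm{ICG}(f,x,y)$ is tasty if $\mathcal{G}(\mathrm{ICG}(f,i,j))=i\oplus\min(f(i),j)$ for all $0\le i\le x$, $0\le j\le y$; $\mathrm{DCG}(f,x,y)$ is tasty if $\mathcal{G}(\mathrm{DCG}(f,i,j))=i\oplus\min(f(i),j)$ for all $0\le i\le x$, $0\le j\le y$. *)

theory Defs
  imports Complex_Main
begin

unbundle bit_operations_syntax

text \<open>Impartial games are given by a function \<open>opts\<close> mapping each position to its set of options.\<close>

definition mex :: "nat set \<Rightarrow> nat" where
  "mex S = (LEAST n. n \<notin> S)"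

text \<open>For a game with finite play (well-founded option relation), this satisfies the usual
  recursion, see \<open>grundy_rec\<close> below.\<close>

definition grundy :: "('a \<Rightarrow> 'a set) \<Rightarrow> 'a \<Rightarrow> nat" where
  "grundy opts = wfrec {(q, p). q \<in> opts p} (\<lambda>g p. mex (g ` opts p))"

lemma grundy_rec:
  assumes "wf {(q, p). q \<in> opts p}"
  shows "grundy opts p = mex (grundy opts ` opts p)"
proof -
  let ?R = "{(q, p). q \<in> opts p}"
  have "grundy opts p = mex (cut (grundy opts) ?R p ` opts p)"
    unfolding grundy_def by (subst wfrec[OF assms]) simp
  also have "cut (grundy opts) ?R p ` opts p = grundy opts ` opts p"
    by (rule image_cong) (simp_all add: cut_def)
  finally show ?thesis .
qed

text \<open>A chocolate bar is the list of the heights of its columns, column \<open>0\<close> first. The bitter square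
  is the bottom square of column \<open>0\<close>, so every cut leaves at least the first column and at least the
  bottom row.\<close>

definition vertical_cuts :: "nat list \<Rightarrow> nat list set" where
  "vertical_cuts B = {take k B | k. 0 < k \<and> k < length B}"

definition horizontal_cuts :: "nat list \<Rightarrow> nat list set" where
  "horizontal_cuts B = {map (min h) B | h. 0 < h \<and> (\<exists>c\<in>set B. h < c)}"

definition icg_moves :: "nat list \<Rightarrow> nat list set" where
  "icg_moves B = vertical_cuts B \<union> horizontal_cuts B"

text \<open>At least one square of the rightmost column must be removed: either the whole column
  disappears or its height decreases.\<close>

definition dcg_moves :: "nat list \<Rightarrow> nat list set" where
  "dcg_moves B = {B' \<in> vertical_cuts B \<union> horizontal_cuts B.
     length B' < length B \<or> last B' < last B}"

definition bar :: "(nat \<Rightarrow> nat) \<Rightarrow> nat \<Rightarrow> nat \<Rightarrow> nat list" where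
  "bar f x y = map (\<lambda>i. min (f i) y + 1) [0..<x + 1]"

text \<open>\<open>ICG\<close> and \<open>DCG\<close> positions have the same shape \<open>bar f x y\<close>; they differ in the moves and in
  whether \<open>f\<close> is increasing (\<open>mono f\<close>) or decreasing (\<open>antimono f\<close>).\<close>

definition icg_tasty :: "(nat \<Rightarrow> nat) \<Rightarrow> nat \<Rightarrow> nat \<Rightarrow> bool" where
  "icg_tasty f x y \<longleftrightarrow>
     (\<forall>i\<le>x. \<forall>j\<le>y. grundy icg_moves (bar f i j) = i XOR min (f i) j)"

definition dcg_tasty :: "(nat \<Rightarrow> nat) \<Rightarrow> nat \<Rightarrow> nat \<Rightarrow> bool" where
  "dcg_tasty f x y \<longleftrightarrow>
     (\<forall>i\<le>x. \<forall>j\<le>y. grundy dcg_moves (bar f i j) = i XOR min (f i) j)"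

text \<open>\<open>compl_fun f x\<close> is the function $F_x$. For \<open>mono f\<close> the truncated subtractions are exact
  (\<open>int_compl_fun\<close>) and the function is a decreasing chocolate function (\<open>antimono_compl_fun\<close>).\<close>

definition compl_fun :: "(nat \<Rightarrow> nat) \<Rightarrow> nat \<Rightarrow> nat \<Rightarrow> nat" where
  "compl_fun f x z =
     2 ^ nat \<lceil>log 2 (real (f x) + 1)\<rceil> - f (if z \<le> x then z else x) - 1"


lemma wf_icg_moves: "wf {(q, p). q \<in> icg_moves p}"
proof (rule wf_subset[OF wf_measure[of "\<lambda>B. sum_list B + length B"]], clarsimp)
  fix B' B assume "B' \<in> icg_moves B"
  then consider k where "B' = take k B" "k < length B"
    | h c where "B' = map (min h) B" "c \<in> set B" "h < c"
    by (auto simp: icg_moves_def vertical_cuts_def horizontal_cuts_def)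
  then show "sum_list B' + length B' < sum_list B + length B"
  proof cases
    case 1
    have "sum_list B = sum_list (take k B) + sum_list (drop k B)"
      by (metis append_take_drop_id sum_list_append)
    then show ?thesis using 1 by simp
  next
    case (2 h c)
    have le: "sum_list (map (min h) xs) \<le> sum_list xs" for xs
      by (induction xs) auto
    obtain us vs where "B = us @ c # vs"
      using 2 by (meson split_list)
    then show ?thesis
      using 2 le[of us] le[of vs] by simp
  qed
qed

lemma wf_dcg_moves: "wf {(q, p). q \<in> dcg_moves p}"
  by (rule wf_subset[OF wf_icg_moves]) (auto simp: dcg_moves_def icg_moves_def)

lemma vertical_cuts_bar: "vertical_cuts (bar f x y) = {bar f x' y | x'. x' < x}"
proof -
  have take_bar: "take (Suc k) (bar f x y) = bar f k y" if "k < x" for k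
    using that by (simp add: bar_def take_map del: upt_Suc)
  show ?thesis
  proof (intro equalityI subsetI)
    fix B assume "B \<in> vertical_cuts (bar f x y)"
    then obtain k where k: "B = take k (bar f x y)" "0 < k" "k < Suc x"
      by (auto simp: vertical_cuts_def bar_def)
    then obtain k' where "k = Suc k'" by (cases k) auto
    then show "B \<in> {bar f x' y | x'. x' < x}"
      using k take_bar[of k'] by auto
  next
    fix B assume "B \<in> {bar f x' y | x'. x' < x}"
    then obtain k where "k < x" "B = take (Suc k) (bar f x y)"
      using take_bar by force
    then show "B \<in> vertical_cuts (bar f x y)"
      by (auto simp: vertical_cuts_def bar_def simp del: upt_Suc)
  qed
qed

lemma map_min_bar: "y' \<le> y \<Longrightarrow> map (min (Suc y')) (bar f x y) = bar f x y'"
  by (auto simp: bar_def simp del: upt_Suc)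

lemma last_bar: "last (bar f x y) = min (f x) y + 1"
  by (simp add: bar_def)

lemma icg_moves_bar:
  assumes "mono f"
  shows "icg_moves (bar f x y) =
    {bar f x' y | x'. x' < x} \<union> {bar f x y' | y'. y' < min (f x) y}"
proof -
  have ex: "(\<exists>c\<in>set (bar f x y). h < c) \<longleftrightarrow> h < min (f x) y + 1" for h
  proof
    assume "\<exists>c\<in>set (bar f x y). h < c"
    then obtain i where "i \<le> x" "h < min (f i) y + 1"
      unfolding bar_def by (auto simp: less_Suc_eq_le simp del: upt_Suc min_less_iff_conj)
    then show "h < min (f x) y + 1"
      using monoD[OF assms, of i x] by auto
  next
    assume "h < min (f x) y + 1"
    then show "\<exists>c\<in>set (bar f x y). h < c"
      by (auto simp: bar_def)
  qed
  have "horizontal_cuts (bar f x y) = {bar f x y' | y'. y' < min (f x) y}"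
  proof (intro equalityI subsetI)
    fix B assume "B \<in> horizontal_cuts (bar f x y)"
    then obtain h where h: "B = map (min h) (bar f x y)" "0 < h" "h < min (f x) y + 1"
      by (auto simp: horizontal_cuts_def ex)
    then obtain y' where "h = Suc y'" by (cases h) auto
    then show "B \<in> {bar f x y' | y'. y' < min (f x) y}"
      using h by (auto simp: map_min_bar)
  next
    fix B assume "B \<in> {bar f x y' | y'. y' < min (f x) y}"
    then obtain y' where "y' < min (f x) y" "B = map (min (Suc y')) (bar f x y)"
      using map_min_bar[of _ y f x] by fastforce
    then show "B \<in> horizontal_cuts (bar f x y)"
      unfolding horizontal_cuts_def ex by auto
  qed
  then show ?thesis by (simp add: icg_moves_def vertical_cuts_bar)
qed

lemma dcg_moves_bar:
  "dcg_moves (bar f x y) =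
    {bar f x' y | x'. x' < x} \<union> {bar f x y' | y'. y' < min (f x) y}"
proof (intro equalityI subsetI)
  fix B assume "B \<in> dcg_moves (bar f x y)"
  then have B: "B \<in> vertical_cuts (bar f x y) \<or> B \<in> horizontal_cuts (bar f x y)"
    and less: "length B < length (bar f x y) \<or> last B < last (bar f x y)"
    by (auto simp: dcg_moves_def)
  show "B \<in> {bar f x' y | x'. x' < x} \<union> {bar f x y' | y'. y' < min (f x) y}"
  proof (cases "B \<in> vertical_cuts (bar f x y)")
    case True
    then show ?thesis by (simp add: vertical_cuts_bar)
  next
    case False
    with B obtain h where h: "B = map (min h) (bar f x y)" "0 < h"
      by (auto simp: horizontal_cuts_def)
    moreover have "last B = min h (min (f x) y + 1)"
      unfolding h(1) by (subst last_map) (auto simp: last_bar, simp add: bar_def)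
    ultimately have "h < min (f x) y + 1"
      using less by (auto simp: last_bar)
    moreover obtain y' where "h = Suc y'"
      using h(2) by (cases h) auto
    ultimately show ?thesis
      using h by (auto simp: map_min_bar)
  qed
next
  fix B assume "B \<in> {bar f x' y | x'. x' < x} \<union> {bar f x y' | y'. y' < min (f x) y}"
  then consider x' where "x' < x" "B = bar f x' y" | y' where "y' < min (f x) y" "B = bar f x y'"
    by blast
  then show "B \<in> dcg_moves (bar f x y)"
  proof cases
    case 1
    then have "B \<in> vertical_cuts (bar f x y)"
      by (auto simp: vertical_cuts_bar)
    then show ?thesis using 1 by (simp add: dcg_moves_def bar_def del: upt_Suc)
  next
    case (2 y')
    have "last (bar f x y) \<in> set (bar f x y)"
      by (rule last_in_set) (simp add: bar_def)
    moreover have "Suc y' < last (bar f x y)"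
      using 2 by (simp add: last_bar)
    moreover have "B = map (min (Suc y')) (bar f x y)"
      using 2 by (simp add: map_min_bar)
    ultimately have "B \<in> horizontal_cuts (bar f x y)"
      unfolding horizontal_cuts_def by blast
    then show ?thesis using 2 by (auto simp: dcg_moves_def last_bar)
  qed
qed

lemma Suc_le_compl_power: "f x + 1 \<le> 2 ^ nat \<lceil>log 2 (real (f x) + 1)\<rceil>"
proof -
  have "real (f x) + 1 = 2 powr log 2 (real (f x) + 1)"
    by simp
  also have "\<dots> \<le> 2 powr real (nat \<lceil>log 2 (real (f x) + 1)\<rceil>)"
    by (rule powr_mono) linarith+
  also have "\<dots> = real (2 ^ nat \<lceil>log 2 (real (f x) + 1)\<rceil>)"
    by (subst powr_realpow) simp_all
  finally show ?thesis
    by linarith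
qed

lemma int_compl_fun:
  assumes "mono f" "z \<le> x"
  shows "int (compl_fun f x z) = 2 ^ nat \<lceil>log 2 (real (f x) + 1)\<rceil> - int (f z) - 1"
proof -
  have "f z + 1 \<le> 2 ^ nat \<lceil>log 2 (real (f x) + 1)\<rceil>"
    using Suc_le_compl_power[of f x] monoD[OF assms] by linarith
  then show ?thesis
    using assms(2) by (simp add: compl_fun_def of_nat_diff)
qed

lemma antimono_compl_fun:
  assumes "mono f"
  shows "antimono (compl_fun f x)"
proof (rule antimonoI)
  fix u v :: nat assume "u \<le> v"
  then have "f (if u \<le> x then u else x) \<le> f (if v \<le> x then v else x)"
    by (intro monoD[OF assms]) auto
  then show "compl_fun f x v \<le> compl_fun f x u"
    unfolding compl_fun_def by (intro diff_le_mono diff_le_mono2)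
qed

end

theory Submission
  imports Defs
begin

text \<open>
  The theorem holds because tastiness is governed by a condition on binary expansions that does not
  see the difference between \<open>f\<close> and its complement. Call \<open>g\<close> bit causal if the bits of \<open>g u\<close> from
  position \<open>k\<close> upwards depend only on the bits of \<open>u\<close> strictly above position \<open>k\<close>. On \<open>{0..x}\<close>,
  where \<open>f\<close> stays below a power of two \<open>2 ^ m\<close>, the function $F_x$ is obtained from \<open>f\<close> by flipping
  the lowest \<open>m\<close> bits (\<open>mask_minus_eq_xor\<close>), so it is bit causal as soon as \<open>f\<close> is. Two things remain.

  Bit causality of \<open>g\<close> on \<open>{0..x}\<close> suffices for the \<open>DCG\<close> values (\<open>grundy_dcg_bar\<close>).
  Truncating \<open>g\<close> at height \<open>y\<close> preserves bit causality. At the highest bit where \<open>u\<close>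
  and \<open>v\<close> differ, \<open>g u\<close> and \<open>g v\<close> agree, so \<open>u \<mapsto> u XOR g u\<close> is injective; this says that no vertical
  cut keeps the value. Counting turns injectivity into surjectivity from a dyadic block of columns
  onto a dyadic block of values, and this provides the vertical cuts that the mex needs.

  Conversely, an increasing \<open>f\<close> with tasty \<open>ICG\<close> bars is bit causal (\<open>bit_causal_if_icg_tasty\<close>). By
  induction on the number of columns, only the last column \<open>n\<close> can violate the condition. A violation
  at the lowest possible bit \<open>i\<close> means that \<open>n\<close> is in the upper half of a block while its height jumps
  past the top of the height block \<open>c\<close> (of size \<open>2 ^ i\<close>) of the lower half. If \<open>c\<close> is even, truncate
  at exactly that top: the lower half already takes every value in the block where the value of
  column \<open>n\<close> should be (\<open>no_jump_from_even_block\<close>). If \<open>c\<close> is odd, some smaller value must be reached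
  from column \<open>n\<close>; a column reaching it lies outside the block of \<open>n\<close> and exhibits an even jump at a
  higher bit (\<open>bit_causal_step\<close>).
\<close>

unbundle bit_operations_syntax

section \<open>Binary expansions and minimal excluded values\<close>

lemma div_power_xor: "((a::nat) XOR b) div 2 ^ k = (a div 2 ^ k) XOR (b div 2 ^ k)"
  by (simp flip: drop_bit_eq_div add: drop_bit_xor)

lemma Suc_eq_xor_1: "even (a::nat) \<Longrightarrow> Suc a = a XOR 1"
  using xor_one_eq[of a] by simp

lemma even_if_le_xor_1: "(a::nat) \<le> a XOR 1 \<Longrightarrow> even a"
  using xor_one_eq[of a] by (cases "even a") (auto elim: oddE)

lemma div_power_Suc: "(a::nat) div 2 ^ Suc k = a div 2 ^ k div 2"
  by (metis div_mult2_eq power_Suc2)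

lemma div_power_eq_mono:
  assumes "(a::nat) div 2 ^ j = b div 2 ^ j" "j \<le> k"
  shows "a div 2 ^ k = b div 2 ^ k"
proof -
  have "(2::nat) ^ k = 2 ^ j * 2 ^ (k - j)"
    using assms(2) by (simp flip: power_add)
  then show ?thesis
    using assms(1) by (simp add: div_mult2_eq)
qed

lemma less_if_div_power: "(m::nat) div 2 ^ k < n div 2 ^ k \<Longrightarrow> m < n"
  by (meson div_le_mono leD leI)

lemma same_half_imp_adjacent:
  "(p::nat) < q \<Longrightarrow> p div 2 = q div 2 \<Longrightarrow> even p \<and> q = Suc p"
  by presburger

text \<open>The highest bit at which two numbers differ, expressed by quotients: at that bit the smaller
  number has a \<open>0\<close> and the larger one a \<open>1\<close>, and all higher bits agree.\<close>

lemma less_top_bit: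
  "(m::nat) < n \<Longrightarrow> \<exists>k. even (m div 2 ^ k) \<and> n div 2 ^ k = Suc (m div 2 ^ k)"
proof (induction n arbitrary: m rule: less_induct)
  case (less n)
  show ?case
  proof (cases "m div 2 = n div 2")
    case True
    then have "even (m div 2 ^ 0) \<and> n div 2 ^ 0 = Suc (m div 2 ^ 0)"
      using less.prems by simp presburger
    then show ?thesis by blast
  next
    case False
    then have "m div 2 < n div 2" "n div 2 < n"
      using less.prems by presburger+
    from less.IH[OF this(2,1)] obtain k
      where "even (m div 2 div 2 ^ k)" "n div 2 div 2 ^ k = Suc (m div 2 div 2 ^ k)"
      by blast
    then have "even (m div 2 ^ Suc k) \<and> n div 2 ^ Suc k = Suc (m div 2 ^ Suc k)"
      by (simp add: div_mult2_eq)
    then show ?thesis by blast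
  qed
qed

lemma top_differing_bit:
  assumes "(u::nat) \<noteq> v"
  shows "\<exists>k. u div 2 ^ Suc k = v div 2 ^ Suc k \<and> u div 2 ^ k \<noteq> v div 2 ^ k"
  using assms
proof (induction u v rule: linorder_wlog)
  case (le m n)
  then obtain k where k: "even (m div 2 ^ k)" "n div 2 ^ k = Suc (m div 2 ^ k)"
    using less_top_bit[of m n] by auto
  then have "m div 2 ^ Suc k = n div 2 ^ Suc k"
    unfolding div_power_Suc by simp
  with k(2) show ?case by (metis n_not_Suc_n)
next
  case (sym m n)
  then show ?case by metis
qed

lemma dyadic_block_eq: "{x. x div 2 ^ k = a} = {a * 2 ^ k ..< a * 2 ^ k + (2::nat) ^ k}"
proof (intro set_eqI)
  fix x :: nat
  have "x div 2 ^ k = a \<longleftrightarrow> a \<le> x div 2 ^ k \<and> x div 2 ^ k < Suc a" by auto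
  also have "\<dots> \<longleftrightarrow> a * 2 ^ k \<le> x \<and> x < Suc a * 2 ^ k"
    by (simp only: less_eq_div_iff_mult_less_eq div_less_iff_less_mult zero_less_power zero_less_numeral)
  finally show "x \<in> {x. x div 2 ^ k = a} \<longleftrightarrow> x \<in> {a * 2 ^ k ..< a * 2 ^ k + 2 ^ k}"
    by (simp add: add.commute)
qed

lemma mex_eqI: "v \<notin> S \<Longrightarrow> (\<And>s. s < v \<Longrightarrow> s \<in> S) \<Longrightarrow> mex S = v"
  unfolding mex_def by (rule Least_equality) (auto intro: leI)

lemma mex_notin: "finite S \<Longrightarrow> mex S \<notin> S"
  unfolding mex_def using ex_new_if_finite[OF infinite_UNIV_nat] by (rule LeastI_ex)

lemma less_mex: "s < mex S \<Longrightarrow> s \<in> S"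
  unfolding mex_def using not_less_Least by blast

section \<open>Functions whose leading bits are determined one bit ahead\<close>

text \<open>In terms of bits: changing the lowest \<open>k + 1\<close> bits of the argument changes at most the lowest
  \<open>k\<close> bits of the value. The restriction to arguments below \<open>n\<close> allows an induction over the columns;
  it also fits \<open>compl_fun f x\<close>, which is the complement of \<open>f\<close> only up to the argument \<open>x\<close>.\<close>

definition bit_causal :: "nat \<Rightarrow> (nat \<Rightarrow> nat) \<Rightarrow> bool" where
  "bit_causal n g \<longleftrightarrow> (\<forall>u<n. \<forall>v<n. \<forall>k.
     u div 2 ^ Suc k = v div 2 ^ Suc k \<longrightarrow> g u div 2 ^ k = g v div 2 ^ k)"

lemma bit_causalD:
  "bit_causal n g \<Longrightarrow> u < n \<Longrightarrow> v < n \<Longrightarrow> u div 2 ^ Suc k = v div 2 ^ Suc k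
    \<Longrightarrow> g u div 2 ^ k = g v div 2 ^ k"
  unfolding bit_causal_def by blast

lemma min_div_power: "min (a::nat) b div 2 ^ k = min (a div 2 ^ k) (b div 2 ^ k)"
  by (rule min_of_mono[symmetric]) (auto simp: mono_def div_le_mono)

lemma bit_causal_min: "bit_causal n g \<Longrightarrow> bit_causal n (\<lambda>x. min (g x) y)"
  unfolding bit_causal_def min_div_power by metis

text \<open>At the highest bit where \<open>u\<close> and \<open>v\<close> differ, the values of \<open>g\<close> agree, so nothing can
  compensate the difference.\<close>

lemma bit_causal_xor_inj:
  assumes "bit_causal n g"
  shows "inj_on (\<lambda>x. x XOR g x) {..<n}"
proof (rule inj_onI, rule ccontr)
  fix u v assume uv: "u \<in> {..<n}" "v \<in> {..<n}" "u XOR g u = v XOR g v" "u \<noteq> v"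
  obtain k where k: "u div 2 ^ Suc k = v div 2 ^ Suc k" "u div 2 ^ k \<noteq> v div 2 ^ k"
    using top_differing_bit[OF uv(4)] by blast
  have "g u div 2 ^ k = g v div 2 ^ k"
    using bit_causalD[OF assms _ _ k(1)] uv by simp
  moreover have "u div 2 ^ k XOR g u div 2 ^ k = v div 2 ^ k XOR g v div 2 ^ k"
    using uv(3) by (metis div_power_xor)
  ultimately show False
    using k(2) by (metis xor.assoc xor_self_eq xor.right_neutral)
qed

text \<open>The \<open>2 ^ k\<close> arguments in the block \<open>a\<close> are mapped injectively into the \<open>2 ^ k\<close> numbers of the
  block \<open>a XOR b\<close>, hence onto it.\<close>

lemma bit_causal_xor_covers_block:
  assumes "bit_causal n g"
    and block: "\<And>x. x div 2 ^ k = a \<Longrightarrow> x < n \<and> g x div 2 ^ k = b"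
    and s: "s div 2 ^ k = a XOR b"
  obtains x where "x div 2 ^ k = a" "x XOR g x = s"
proof -
  let ?h = "\<lambda>x. x XOR g x"
  let ?A = "{x. x div 2 ^ k = a}" and ?B = "{x. x div 2 ^ k = a XOR b}"
  have "?h ` ?A = ?B"
  proof (rule card_subset_eq)
    show "finite ?B" by (simp add: dyadic_block_eq)
    show "?h ` ?A \<subseteq> ?B" using block by (auto simp: div_power_xor)
    have "inj_on ?h ?A"
      by (rule inj_on_subset[OF bit_causal_xor_inj[OF assms(1)]]) (use block in auto)
    then show "card (?h ` ?A) = card ?B"
      by (simp add: card_image dyadic_block_eq)
  qed
  then show thesis using s that by (smt (verit) imageE mem_Collect_eq)
qed

text \<open>As in Nim, look at the highest bit \<open>k\<close> where \<open>s\<close> and \<open>x XOR g x\<close> differ; exactly one of \<open>x\<close> and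
  \<open>g x\<close> has this bit set. If it is \<open>g x\<close>, lower the height to \<open>x XOR s\<close>. If it is \<open>x\<close>, clear this bit
  of \<open>x\<close>: the resulting block of columns lies below \<open>x\<close>, its heights share the bits of \<open>g x\<close> from \<open>k\<close>
  upwards, and it covers the block of values that contains \<open>s\<close>.\<close>

lemma bit_causal_xor_reaches:
  assumes "bit_causal (Suc x) g" and "s < x XOR g x"
  shows "(\<exists>x'<x. x' XOR g x' = s) \<or> (\<exists>y'<g x. x XOR y' = s)"
proof -
  obtain k where k: "even (s div 2 ^ k)" "(x XOR g x) div 2 ^ k = Suc (s div 2 ^ k)"
    using less_top_bit[OF assms(2)] by blast
  define X Y S where "X = x div 2 ^ k" and "Y = g x div 2 ^ k" and "S = s div 2 ^ k"
  have XY: "X XOR Y = S XOR 1"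
    using k unfolding X_def Y_def S_def by (metis div_power_xor Suc_eq_xor_1)
  have "even S" using k by (simp add: S_def)
  show ?thesis
  proof (cases "odd Y")
    case True
    then obtain Z where Z: "even Z" "Y = Suc Z"
      by (metis even_Suc not0_implies_Suc odd_pos less_numeral_extra(3))
    then have "(x XOR s) div 2 ^ k = Z"
      using XY unfolding div_power_xor X_def[symmetric] S_def[symmetric]
      by (metis Suc_eq_xor_1 xor.assoc xor.commute xor_self_eq xor.right_neutral)
    then have "x XOR s < g x"
      using Z by - (rule less_if_div_power[of _ k], simp add: Y_def)
    moreover have "x XOR (x XOR s) = s"
      by (simp flip: xor.assoc)
    ultimately show ?thesis by blast
  next
    case False
    have "odd (X XOR Y)" using \<open>even S\<close> XY by (simp add: even_xor_iff)
    then have "odd X" using False by (simp add: even_xor_iff)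
    then obtain a where a: "even a" "X = Suc a"
      by (metis even_Suc not0_implies_Suc odd_pos less_numeral_extra(3))
    have block: "z < Suc x \<and> g z div 2 ^ k = Y" if "z div 2 ^ k = a" for z
    proof -
      have "z < x" using that a by - (rule less_if_div_power[of _ k], simp add: X_def)
      moreover have "z div 2 ^ Suc k = x div 2 ^ Suc k"
        using that a unfolding div_power_Suc X_def by simp
      ultimately show ?thesis
        using bit_causalD[OF assms(1), of z x k] by (simp add: Y_def)
    qed
    have "s div 2 ^ k = a XOR Y"
      using XY a unfolding S_def[symmetric]
      by (metis Suc_eq_xor_1 xor.assoc xor.commute xor_self_eq xor.right_neutral)
    from bit_causal_xor_covers_block[OF assms(1) block this]
    obtain z where z: "z div 2 ^ k = a" "z XOR g z = s" by blast
    have "z < x" using z a by - (rule less_if_div_power[of _ k], simp add: X_def)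
    then show ?thesis using z by blast
  qed
qed

section \<open>Bit causality makes decreasing bars tasty\<close>

lemma grundy_dcg_bar:
  assumes "bit_causal (Suc x) g"
  shows "grundy dcg_moves (bar g x y) = x XOR min (g x) y"
  using assms
proof (induction "x + y" arbitrary: x y rule: less_induct)
  case less
  let ?g = "\<lambda>x. min (g x) y"
  have g: "bit_causal (Suc x) ?g" by (rule bit_causal_min[OF less.prems])
  have vert: "grundy dcg_moves (bar g x' y) = x' XOR ?g x'" if "x' < x" for x'
    using less.hyps[of x' y] less.prems that by (auto simp: bit_causal_def)
  have hor: "grundy dcg_moves (bar g x y') = x XOR y'" if "y' < ?g x" for y'
    using less.hyps[of x y'] less.prems that by auto
  have opts: "grundy dcg_moves ` dcg_moves (bar g x y) =
      {x' XOR ?g x' | x'. x' < x} \<union> {x XOR y' | y'. y' < ?g x}" (is "_ = ?S")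
  proof -
    have "grundy dcg_moves ` dcg_moves (bar g x y) =
        {grundy dcg_moves (bar g x' y) | x'. x' < x} \<union>
        {grundy dcg_moves (bar g x y') | y'. y' < ?g x}"
      unfolding dcg_moves_bar by blast
    also have "\<dots> = ?S" by (rule arg_cong2[where f = union]) (use vert hor in force)+
    finally show ?thesis .
  qed
  have "mex ?S = x XOR ?g x"
  proof (rule mex_eqI)
    have "x XOR ?g x \<noteq> x' XOR ?g x'" if "x' < x" for x'
      using inj_onD[OF bit_causal_xor_inj[OF g], of x x'] that by auto
    moreover have "x XOR ?g x \<noteq> x XOR y'" if "y' < ?g x" for y'
      using that by (metis less_irrefl xor.assoc xor_self_eq xor.left_neutral)
    ultimately show "x XOR ?g x \<notin> ?S" by blast
  next
    fix s assume "s < x XOR ?g x"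
    then show "s \<in> ?S" using bit_causal_xor_reaches[OF g] by blast
  qed
  then show ?case
    using grundy_rec[OF wf_dcg_moves, of "bar g x y"] opts by simp
qed

section \<open>Tasty increasing bars force bit causality\<close>

context
  fixes f :: "nat \<Rightarrow> nat"
  assumes mono: "mono f"
    and tasty: "\<And>x y. icg_tasty f x y"
begin

lemma icg_value_eq_mex:
  "x XOR min (f x) y =
     mex ({x' XOR min (f x') y | x'. x' < x} \<union> {x XOR y' | y'. y' < min (f x) y})"
proof -
  have val: "grundy icg_moves (bar f i j) = i XOR min (f i) j" for i j
    using tasty[of i j] unfolding icg_tasty_def by blast
  have "grundy icg_moves ` icg_moves (bar f x y) =
      {grundy icg_moves (bar f x' y) | x'. x' < x} \<union>
      {grundy icg_moves (bar f x y') | y'. y' < min (f x) y}"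
    unfolding icg_moves_bar[OF mono] by blast
  also have "\<dots> = {x' XOR min (f x') y | x'. x' < x} \<union> {x XOR y' | y'. y' < min (f x) y}"
    unfolding val by (rule arg_cong2[where f = union]) (force simp: min_absorb2)+
  finally show ?thesis
    using grundy_rec[OF wf_icg_moves, of "bar f x y"] val by simp
qed

lemma icg_values_distinct:
  assumes "x' < x"
  shows "x' XOR min (f x') y \<noteq> x XOR min (f x) y"
proof -
  have "x XOR min (f x) y
      \<notin> {x' XOR min (f x') y | x'. x' < x} \<union> {x XOR y' | y'. y' < min (f x) y}"
    by (subst icg_value_eq_mex) (rule mex_notin, simp)
  with assms show ?thesis by auto
qed

lemma icg_values_reach:
  assumes "s < x XOR min (f x) y"
  shows "(\<exists>x'<x. x' XOR min (f x') y = s) \<or> (\<exists>y'<min (f x) y. x XOR y' = s)"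
proof -
  have "s \<in> {x' XOR min (f x') y | x'. x' < x} \<union> {x XOR y' | y'. y' < min (f x) y}"
    by (rule less_mex, rule less_le_trans[OF assms], rule eq_imp_le, rule icg_value_eq_mex)
  then show ?thesis by blast
qed

text \<open>The columns in block \<open>a\<close> are the lower half of a larger block with \<open>n\<close> in its upper half, and
  bit causality gives all of them heights in block \<open>e\<close>. If \<open>f n\<close> reached the height \<open>y = (e + 1) 2^k\<close>, truncation at \<open>y\<close> would give column \<open>n\<close> the value
  \<open>n XOR y\<close>. Relative to the lower half, bit \<open>k\<close> flips in the column and in the height, and the two
  flips cancel; but all values of that block are taken by columns of the lower half.\<close>

lemma no_jump_from_even_block:
  assumes causal: "bit_causal n f"
    and a: "even a" "n div 2 ^ k = Suc a"
    and w: "w div 2 ^ k = a" "f w div 2 ^ k = e" "even e"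
  shows "f n < Suc e * 2 ^ k"
proof (rule ccontr)
  let ?y = "Suc e * 2 ^ k"
  assume "\<not> f n < ?y"
  have below: "z < n" if "z div 2 ^ k = a" for z
    using that a by - (rule less_if_div_power[of _ k], simp)
  have block: "z < n \<and> f z div 2 ^ k = e" if "z div 2 ^ k = a" for z
    using bit_causalD[OF causal below[OF that] below[OF w(1)], of k] w that below[OF that]
    by (simp add: div_power_Suc del: power_Suc)
  have "(n XOR ?y) div 2 ^ k = Suc a XOR Suc e"
    unfolding div_power_xor a(2) by simp
  also have "\<dots> = a XOR e"
    using a(1) w(3) by (metis Suc_eq_xor_1 xor.assoc xor.commute xor_self_eq xor.right_neutral)
  finally obtain z where z: "z div 2 ^ k = a" "z XOR f z = n XOR ?y"
    using bit_causal_xor_covers_block[OF causal block] by metis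
  have "f z < ?y"
    using block[OF z(1)] by - (rule less_if_div_power[of _ k], simp)
  then have "z XOR min (f z) ?y = n XOR min (f n) ?y"
    using z(2) \<open>\<not> f n < ?y\<close> by simp
  then show False
    using icg_values_distinct[OF below[OF z(1)]] by blast
qed

text \<open>The induction on \<open>i\<close> makes \<open>i\<close> the lowest bit of a violation, which puts \<open>n\<close> in the upper half
  and \<open>u\<close> in the lower half of their common block of size \<open>2 ^ (i + 1)\<close>. The jump then leaves a height
  block \<open>c\<close> that is odd by \<open>no_jump_from_even_block\<close>. Truncate at its top \<open>y = (c + 1) 2^i\<close>; since
  \<open>c + 1\<close> is even, \<open>s = n XOR y XOR 2^i\<close> is smaller than the value \<open>n XOR y\<close> and must be an option.\<close>

lemma bit_causal_step:
  assumes causal: "bit_causal n f"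
    and "u < n" "u div 2 ^ Suc i = n div 2 ^ Suc i"
  shows "f u div 2 ^ i = f n div 2 ^ i"
  using assms(2,3)
proof (induction i arbitrary: u rule: less_induct)
  case (less i)
  show ?case
  proof (cases "u div 2 ^ i = n div 2 ^ i")
    case True
    then obtain j where j: "i = Suc j" using less.prems by (cases i) auto
    then have "f u div 2 ^ j = f n div 2 ^ j"
      using less.IH[of j u] less.prems True by simp
    then show ?thesis by (rule div_power_eq_mono) (simp add: j)
  next
    case False
    define a where "a = u div 2 ^ i"
    define c where "c = f u div 2 ^ i"
    have "a \<le> n div 2 ^ i" unfolding a_def using less.prems by (simp add: div_le_mono)
    then have "even a \<and> n div 2 ^ i = Suc a"
      using False less.prems(2) unfolding div_power_Suc a_def
      by (intro same_half_imp_adjacent) simp_all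
    then have a: "even a" "n div 2 ^ i = Suc a" by blast+
    show ?thesis
    proof (rule ccontr)
      assume neq: "f u div 2 ^ i \<noteq> f n div 2 ^ i"
      let ?y = "Suc c * 2 ^ i"
      have "f u \<le> f n" using less.prems mono by (simp add: monoD)
      then have "Suc c \<le> f n div 2 ^ i"
        using neq div_le_mono[of "f u" "f n" "2 ^ i"] unfolding c_def by simp
      then have y: "?y \<le> f n"
        by (metis div_times_less_eq_dividend le_trans mult_le_mono1)
      have "odd c"
        using no_jump_from_even_block[OF causal a, of u c] y by (auto simp: a_def c_def)
      have same: "f z div 2 ^ i = c" if "z < n" "z div 2 ^ Suc i = n div 2 ^ Suc i" for z
        unfolding c_def by (rule bit_causalD[OF causal]) (use that less.prems in simp_all)
      have "(n - 1) div 2 ^ Suc i = n div 2 ^ Suc i"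
      proof (rule antisym)
        show "(n - 1) div 2 ^ Suc i \<le> n div 2 ^ Suc i" by (rule div_le_mono) simp
        have "u div 2 ^ Suc i \<le> (n - 1) div 2 ^ Suc i"
          by (rule div_le_mono) (use less.prems in simp)
        then show "n div 2 ^ Suc i \<le> (n - 1) div 2 ^ Suc i" using less.prems by simp
      qed
      then have "f (n - 1) div 2 ^ i = c" using same less.prems by simp
      then have "f (n - 1) < ?y" by - (rule less_if_div_power[of _ i], simp)
      moreover have "f z \<le> f (n - 1)" if "z < n" for z
        by (rule monoD[OF mono]) (use that in simp)
      ultimately have below: "f z < ?y" if "z < n" for z
        using that le_less_trans by blast
      define s where "s = n XOR ?y XOR 2 ^ i"
      have s_div: "s div 2 ^ k = n div 2 ^ k XOR ?y div 2 ^ k" if "i < k" for k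
        unfolding s_def div_power_xor using that by simp
      have "s div 2 ^ i = a XOR Suc c"
      proof -
        have "s div 2 ^ i = Suc a XOR Suc c XOR 1"
          unfolding s_def div_power_xor a(2) by simp
        then show ?thesis
          using a(1) by (metis Suc_eq_xor_1 xor.assoc xor.commute xor_self_eq xor.right_neutral)
      qed
      moreover have "(n XOR ?y) div 2 ^ i = Suc (a XOR Suc c)"
      proof -
        have "even (a XOR Suc c)" using a(1) \<open>odd c\<close> by (simp add: even_xor_iff)
        then have "Suc (a XOR Suc c) = Suc a XOR Suc c"
          using a(1) by (metis Suc_eq_xor_1 xor.assoc xor.commute)
        then show ?thesis unfolding div_power_xor a(2) by simp
      qed
      ultimately have "s < n XOR ?y"
        by - (rule less_if_div_power[of _ i], simp)
      then consider z where "z < n" "z XOR f z = s" | y' where "y' < ?y" "n XOR y' = s"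
        using icg_values_reach[of s n ?y] y below by (fastforce simp: min_absorb1 min_absorb2)
      then show False
      proof cases
        case (1 z)
        \<comment> \<open>\<open>k\<close> is the highest bit where \<open>z\<close> and \<open>n\<close> differ.\<close>
        obtain k where k: "even (z div 2 ^ k)" "n div 2 ^ k = Suc (z div 2 ^ k)"
          using less_top_bit[OF 1(1)] by blast
        show False
        proof (cases "i < k")
          case True
          \<comment> \<open>Bit \<open>k\<close> of \<open>z\<close> differs from that of \<open>n\<close>, so bit \<open>k\<close> of \<open>f z\<close> must differ from that of
            the truncation height. As \<open>f z\<close> is below that height, it lies in an even block from which
            \<open>f n\<close> jumps away.\<close>
          have "z div 2 ^ k XOR f z div 2 ^ k = Suc (z div 2 ^ k) XOR ?y div 2 ^ k"
            using s_div[OF True] 1(2) k(2) by (metis div_power_xor)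
          then have yk: "?y div 2 ^ k = f z div 2 ^ k XOR 1"
            using k(1)
            by (metis Suc_eq_xor_1 xor.assoc xor.commute xor_self_eq xor.right_neutral)
          have "f z div 2 ^ k \<le> ?y div 2 ^ k"
            using below[OF 1(1)] by (intro div_le_mono) simp
          then have e: "even (f z div 2 ^ k)"
            unfolding yk by (rule even_if_le_xor_1)
          have "f n < Suc (f z div 2 ^ k) * 2 ^ k"
            by (rule no_jump_from_even_block[OF causal k refl refl e])
          also have "\<dots> = ?y div 2 ^ k * 2 ^ k" unfolding yk Suc_eq_xor_1[OF e] ..
          also have "\<dots> \<le> ?y" by (rule div_times_less_eq_dividend)
          finally show False using y by simp
        next
          case False
          \<comment> \<open>Now \<open>z\<close> shares the block of \<open>n\<close>, so its height is in block \<open>c\<close>. Passing from \<open>c\<close> to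
            \<open>c + 1\<close> carries into higher bits, which nothing else changes.\<close>
          have "z div 2 ^ Suc k = n div 2 ^ Suc k"
            using k unfolding div_power_Suc by simp
          then have zn: "z div 2 ^ Suc i = n div 2 ^ Suc i"
            by (rule div_power_eq_mono) (use False in simp)
          have "z div 2 ^ Suc i XOR f z div 2 ^ Suc i = n div 2 ^ Suc i XOR ?y div 2 ^ Suc i"
            using s_div[of "Suc i"] 1(2) by (metis div_power_xor lessI)
          then have "f z div 2 ^ Suc i = ?y div 2 ^ Suc i"
            unfolding zn by (metis xor.assoc xor_self_eq xor.left_neutral)
          then have "c div 2 = Suc c div 2"
            unfolding div_power_Suc same[OF 1(1) zn] by simp
          then show False using \<open>odd c\<close> by presburger
        qed
      next
        case (2 y')
        \<comment> \<open>Setting the zero bit \<open>i\<close> of the truncation height makes it larger, not smaller.\<close>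
        then have "y' = ?y XOR 2 ^ i"
          unfolding s_def by (metis xor.assoc xor_self_eq xor.left_neutral)
        then have "y' div 2 ^ i = Suc c XOR 1"
          by (simp only: div_power_xor) simp
        also have "\<dots> = Suc (Suc c)"
          using \<open>odd c\<close> Suc_eq_xor_1[of "Suc c"] by simp
        finally have "y' div 2 ^ i = Suc (Suc c)" .
        moreover have "y' div 2 ^ i \<le> ?y div 2 ^ i" using 2 by (intro div_le_mono) simp
        ultimately show False by simp
      qed
    qed
  qed
qed

lemma bit_causal_if_icg_tasty: "bit_causal n f"
proof (induction n)
  case 0
  show ?case by (simp add: bit_causal_def)
next
  case (Suc n)
  show ?case
    unfolding bit_causal_def
    using Suc bit_causal_step[OF Suc] by (metis bit_causalD less_Suc_eq)
qed

end

section \<open>Complementing the function\<close>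

lemma mask_minus_eq_xor:
  assumes "p < (2::nat) ^ m"
  shows "2 ^ m - 1 - p = mask m XOR p"
proof -
  have p: "take_bit m p = p" using assms by (simp add: take_bit_nat_eq_self_iff)
  have bit: "bit p i \<Longrightarrow> i < m" for i using p by (metis bit_take_bit_iff)
  have "p AND (mask m XOR p) = 0" "p OR (mask m XOR p) = mask m"
    using bit by (simp_all add: bit_eq_iff bit_simps) blast+
  then have "p + (mask m XOR p) = 2 ^ m - 1"
    by (simp add: disjunctive_add_eq_or mask_eq_exp_minus_1)
  then show ?thesis by simp
qed

lemma bit_causal_compl_fun:
  assumes "mono f" "bit_causal (Suc x) f"
  shows "bit_causal (Suc x) (compl_fun f x)"
proof -
  define m where "m = nat \<lceil>log 2 (real (f x) + 1)\<rceil>"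
  have "compl_fun f x z = mask m XOR f z" if "z < Suc x" for z
  proof -
    have "f z < 2 ^ m"
      using Suc_le_compl_power[of f x] monoD[OF assms(1), of z x] that unfolding m_def by simp
    then show ?thesis
      using mask_minus_eq_xor[of "f z" m] that by (simp add: compl_fun_def m_def)
  qed
  then show ?thesis
    using assms(2) unfolding bit_causal_def by (metis div_power_xor)
qed

theorem theorem14:
  fixes f :: "nat \<Rightarrow> nat"
  assumes "mono f"
    and "\<forall>x y. icg_tasty f x y"
  shows "\<forall>x y. dcg_tasty (compl_fun f x) x y"
proof (intro allI)
  fix x y
  have "bit_causal (Suc x) (compl_fun f x)"
    using assms by (intro bit_causal_compl_fun bit_causal_if_icg_tasty) auto
  then have "bit_causal (Suc i) (compl_fun f x)" if "i \<le> x" for i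
    using that by (auto simp: bit_causal_def)
  then show "dcg_tasty (compl_fun f x) x y"
    unfolding dcg_tasty_def using grundy_dcg_bar by blast
qed

end
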